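(* Let $\Psi=(S,C,F)$ be a proper expansion system, and let $\hat C$ be endowed with the discrete product topology $\mathscr D^*$. Assume $S_0$ has a topology which is weaker than (coarser than) or equal to $\hat P^{-1}(\mathscr D)$, where $\mathscr D$ is the discrete topology on $\hat C$. Let $y\in S_0$. If $\hat P\colon S_0\to(\hat C,\mathscr D^* )$ is closed at the point $\hat c=\hat P(y)\in\hat C$, then $\Psi$ is accurate with respect to $y$.
   Context: $\mathbb N=\{0,1,2,\dots\}$. An expansion system $\Psi=(S,C,F)$ consists of sets $S_i$ ($i\in\mathbb N$), each with a distinguished neutral element $\nu_i\in S_i$, sets $C_i$ ($i\in\mathbb N$), and maps $P_i\colon S_i\to C_i$ and $E_i\colon S_i\to S_{i+1}$ such that $E_i(\nu_i)=\nu_{i+1}$ and $F_i=(P_i,E_i)\colon S_i\to C_i\times S_{i+1}$ is injective, for all $i$. For $y\in S_0$ put $y_0=y$, $y_{i+1}=E_i(y_i)$, $\hat P_i(y)=c_i=P_i(y_i)$. Put $\hat C=\prod_{i\in\mathbb N}C_i$ and $\hat P\colon S_0\to\hat C$, $\hat P(y)=(c_0,c_1,\dots)$. Properness and convergents: given $y\in S_0$ with coefficients $c_i$ and $n\in\mathbb N$, set $y^{[n]}_n=\nu_n$ and, for $i=n-1,\dots,0$, $y^{[n]}_i=F_i^{-1}(c_i,y^{[n]}_{i+1})$, provided $(c_i,y^{[n]}_{i+1})\in F_i(S_i)$. If this proviso holds at every step, $\Psi$ is called proper at order $n$ with respect to $y$, and $y^{[n]}:=y^{[n]}_0$ is the $n$-th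 convergent of $y$. $\Psi$ is proper if it is proper at every order with respect to every $y\in S_0$. $\Psi$ is accurate with respect to $y$ if the sequence $(y^{[n]})_n$ converges to $y$ in the topology of $S_0$. Topologies: $\mathscr D^*$ is the product topology on $\hat C$ when every $C_i$ is discrete. For a topology $\mathscr C$ on $\hat C$, $\hat P^{-1}(\mathscr C)$ is the topology on $S_0$ generated by the sets $\hat P^{-1}(U)$, $U\in\mathscr C$. A map $f\colon X\to Y$ between topological spaces is closed at a point $q\in Y$ if for every open set $U\supseteq f^{-1}(q)$ there is an open neighborhood $V$ of $q$ with $f^{-1}(V)\subseteq U$. *)

theory Defs
  imports "HOL-Analysis.Function_Topology"
begin

text \<open>
  The sets \<open>S\<^sub>i\<close> are subsets of one ambient type and likewise the \<open>C\<^sub>i\<close>; they need not be disjoint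
  or nested.
\<close>

record ('s, 'c) expansion_data =
  state_set :: "nat \<Rightarrow> 's set"
  neutral :: "nat \<Rightarrow> 's"
  coeff_set :: "nat \<Rightarrow> 'c set"
  coeff_map :: "nat \<Rightarrow> 's \<Rightarrow> 'c"
  shift_map :: "nat \<Rightarrow> 's \<Rightarrow> 's"

definition F_map :: "('s, 'c) expansion_data \<Rightarrow> nat \<Rightarrow> 's \<Rightarrow> 'c \<times> 's" where
  "F_map \<Psi> i x = (coeff_map \<Psi> i x, shift_map \<Psi> i x)"

definition expansion_system :: "('s, 'c) expansion_data \<Rightarrow> bool" where
  "expansion_system \<Psi> \<longleftrightarrow>
    (\<forall>i. neutral \<Psi> i \<in> state_set \<Psi> i \<and>
         coeff_map \<Psi> i \<in> state_set \<Psi> i \<rightarrow> coeff_set \<Psi> i \<and>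
         shift_map \<Psi> i \<in> state_set \<Psi> i \<rightarrow> state_set \<Psi> (Suc i) \<and>
         shift_map \<Psi> i (neutral \<Psi> i) = neutral \<Psi> (Suc i) \<and>
         inj_on (F_map \<Psi> i) (state_set \<Psi> i))"

primrec iterate :: "('s, 'c) expansion_data \<Rightarrow> 's \<Rightarrow> nat \<Rightarrow> 's" where
  "iterate \<Psi> y 0 = y"
| "iterate \<Psi> y (Suc i) = shift_map \<Psi> i (iterate \<Psi> y i)"

definition P_hat :: "('s, 'c) expansion_data \<Rightarrow> 's \<Rightarrow> nat \<Rightarrow> 'c" where
  "P_hat \<Psi> y = (\<lambda>i. coeff_map \<Psi> i (iterate \<Psi> y i))"

definition C_hat :: "('s, 'c) expansion_data \<Rightarrow> (nat \<Rightarrow> 'c) set" where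
  "C_hat \<Psi> = (\<Pi>\<^sub>E i\<in>UNIV. coeff_set \<Psi> i)"

definition discrete_product :: "('s, 'c) expansion_data \<Rightarrow> (nat \<Rightarrow> 'c) topology" where
  "discrete_product \<Psi> = product_topology (\<lambda>i. discrete_topology (coeff_set \<Psi> i)) UNIV"

text \<open>
  \<open>conv_tail \<Psi> y n i\<close> is \<open>y\<^sup>[\<^sup>n\<^sup>]\<^sub>i\<close> for \<open>i \<le> n\<close>. It has its intended meaning only as long as the pairs to
  which \<open>F\<^sub>i\<close> is inverted lie in the image of \<open>F\<^sub>i\<close>, which is what \<open>proper_at\<close> requires.
\<close>

function conv_tail :: "('s, 'c) expansion_data \<Rightarrow> 's \<Rightarrow> nat \<Rightarrow> nat \<Rightarrow> 's" where
  "conv_tail \<Psi> y n i =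
    (if i < n
     then inv_into (state_set \<Psi> i) (F_map \<Psi> i) (P_hat \<Psi> y i, conv_tail \<Psi> y n (Suc i))
     else neutral \<Psi> n)"
  by auto
termination
  by (relation "measure (\<lambda>(\<Psi>, y, n, i). n - i)") auto

declare conv_tail.simps [simp del]

definition proper_at :: "('s, 'c) expansion_data \<Rightarrow> nat \<Rightarrow> 's \<Rightarrow> bool" where
  "proper_at \<Psi> n y \<longleftrightarrow>
    (\<forall>i<n. (P_hat \<Psi> y i, conv_tail \<Psi> y n (Suc i)) \<in> F_map \<Psi> i ` state_set \<Psi> i)"

definition nth_convergent :: "('s, 'c) expansion_data \<Rightarrow> 's \<Rightarrow> nat \<Rightarrow> 's" where
  "nth_convergent \<Psi> y n = conv_tail \<Psi> y n 0"

definition proper :: "('s, 'c) expansion_data \<Rightarrow> bool" where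
  "proper \<Psi> \<longleftrightarrow> (\<forall>y\<in>state_set \<Psi> 0. \<forall>n. proper_at \<Psi> n y)"

text \<open>The first conjunct says that all convergents of \<open>y\<close> exist.\<close>

definition accurate :: "('s, 'c) expansion_data \<Rightarrow> 's topology \<Rightarrow> 's \<Rightarrow> bool" where
  "accurate \<Psi> T y \<longleftrightarrow>
    (\<forall>n. proper_at \<Psi> n y) \<and> limitin T (nth_convergent \<Psi> y) y sequentially"

definition coarser_or_equal :: "'a topology \<Rightarrow> 'a topology \<Rightarrow> bool" where
  "coarser_or_equal T T' \<longleftrightarrow> topspace T = topspace T' \<and> (\<forall>U. openin T U \<longrightarrow> openin T' U)"

definition closed_map_at :: "'a topology \<Rightarrow> 'b topology \<Rightarrow> ('a \<Rightarrow> 'b) \<Rightarrow> 'b \<Rightarrow> bool" where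
  "closed_map_at X Y f q \<longleftrightarrow>
    (\<forall>U. openin X U \<and> {x \<in> topspace X. f x = q} \<subseteq> U \<longrightarrow>
      (\<exists>V. openin Y V \<and> q \<in> V \<and> {x \<in> topspace X. f x \<in> V} \<subseteq> U))"

end

(*
  The n-th convergent of y lies in S_0 and has the same first n coefficients as y, so its image
  under P_hat tends to P_hat y in the discrete product topology. An open neighbourhood U of y is
  a full preimage under P_hat, hence contains the whole fibre over P_hat y; closedness at that
  point then puts P_hat -` V inside U for some neighbourhood V of P_hat y.
*)

theory Submission
  imports Defs
begin

text \<open>Properness puts the pair inside the image of \<open>F_map \<Psi> i\<close>, so the value
  of \<open>inv_into\<close> is a genuine preimage in \<open>state_set \<Psi> i\<close>; applying
  \<open>F_map \<Psi> i\<close> to it returns both components of the pair.\<close>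

lemma F_map_conv_tail:
  assumes "proper_at \<Psi> n y" "i < n"
  shows "conv_tail \<Psi> y n i \<in> state_set \<Psi> i"
    and "coeff_map \<Psi> i (conv_tail \<Psi> y n i) = P_hat \<Psi> y i"
    and "shift_map \<Psi> i (conv_tail \<Psi> y n i) = conv_tail \<Psi> y n (Suc i)"
proof -
  have im: "(P_hat \<Psi> y i, conv_tail \<Psi> y n (Suc i)) \<in> F_map \<Psi> i ` state_set \<Psi> i"
    using assms by (simp add: proper_at_def)
  have eq: "conv_tail \<Psi> y n i =
      inv_into (state_set \<Psi> i) (F_map \<Psi> i) (P_hat \<Psi> y i, conv_tail \<Psi> y n (Suc i))"
    using assms(2) by (subst conv_tail.simps) simp
  show "conv_tail \<Psi> y n i \<in> state_set \<Psi> i"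
    unfolding eq by (rule inv_into_into[OF im])
  have "F_map \<Psi> i (conv_tail \<Psi> y n i) = (P_hat \<Psi> y i, conv_tail \<Psi> y n (Suc i))"
    unfolding eq by (rule f_inv_into_f[OF im])
  then show "coeff_map \<Psi> i (conv_tail \<Psi> y n i) = P_hat \<Psi> y i"
    and "shift_map \<Psi> i (conv_tail \<Psi> y n i) = conv_tail \<Psi> y n (Suc i)"
    by (simp_all add: F_map_def)
qed

lemma nth_convergent_in_state_set:
  assumes "expansion_system \<Psi>" "proper_at \<Psi> n y"
  shows "nth_convergent \<Psi> y n \<in> state_set \<Psi> 0"
\<comment> \<open>For n = 0 no inversion takes place and the convergent is the neutral element of
  \<open>state_set \<Psi> 0\<close>; otherwise index 0 is below n and the previous lemma
  applies.\<close>
proof (cases n)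
  case 0
  then show ?thesis
    using assms(1) by (simp add: nth_convergent_def conv_tail.simps expansion_system_def)
next
  case (Suc m)
  then show ?thesis
    using F_map_conv_tail(1)[OF assms(2), of 0] by (simp add: nth_convergent_def)
qed

text \<open>The convergent is built by inverting the maps backwards from n, so running the shifts
  forwards retraces the tails. The bound includes i = n because the shift identity at i < n reaches
  \<open>Suc i\<close>.\<close>

lemma iterate_nth_convergent:
  assumes "proper_at \<Psi> n y"
  shows "i \<le> n \<Longrightarrow> iterate \<Psi> (nth_convergent \<Psi> y n) i = conv_tail \<Psi> y n i"
  by (induction i) (simp_all add: nth_convergent_def F_map_conv_tail(3)[OF assms])

lemma P_hat_nth_convergent:
  assumes "proper_at \<Psi> n y" "i < n"
  shows "P_hat \<Psi> (nth_convergent \<Psi> y n) i = P_hat \<Psi> y i"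
  using iterate_nth_convergent[OF assms(1), of i] F_map_conv_tail(2)[OF assms] assms(2)
  by (simp add: P_hat_def)

lemma iterate_in_state_set:
  assumes "expansion_system \<Psi>" "x \<in> state_set \<Psi> 0"
  shows "iterate \<Psi> x i \<in> state_set \<Psi> i"
  using assms by (induction i) (auto simp: expansion_system_def)

lemma P_hat_in_C_hat:
  assumes "expansion_system \<Psi>" "x \<in> state_set \<Psi> 0"
  shows "P_hat \<Psi> x \<in> C_hat \<Psi>"
  using assms iterate_in_state_set[OF assms]
  by (fastforce simp: P_hat_def C_hat_def expansion_system_def)

lemma limitin_P_hat_nth_convergent:
  assumes "expansion_system \<Psi>" "\<And>n. proper_at \<Psi> n y" "y \<in> state_set \<Psi> 0"
  shows "limitin (discrete_product \<Psi>) (\<lambda>n. P_hat \<Psi> (nth_convergent \<Psi> y n)) (P_hat \<Psi> y) sequentially"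
  unfolding discrete_product_def limitin_componentwise
proof (intro conjI ballI)
  show "\<forall>\<^sub>F n in sequentially. P_hat \<Psi> (nth_convergent \<Psi> y n)
      \<in> topspace (product_topology (\<lambda>i. discrete_topology (coeff_set \<Psi> i)) UNIV)"
    using P_hat_in_C_hat[OF assms(1) nth_convergent_in_state_set[OF assms(1,2)]]
    by (simp add: C_hat_def)
next
  fix i
  have "\<forall>\<^sub>F n in sequentially. P_hat \<Psi> (nth_convergent \<Psi> y n) i = P_hat \<Psi> y i"
    \<comment> \<open>Strictness matters: the n-th convergent is only known to share the
      coefficients with index below n, so coordinate i is constant from n = i + 1 on.\<close>
    using eventually_gt_at_top[of i]
    by eventually_elim (rule P_hat_nth_convergent[OF assms(2)])
  moreover have "P_hat \<Psi> y i \<in> coeff_set \<Psi> i"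
    using P_hat_in_C_hat[OF assms(1,3)] by (auto simp: C_hat_def)
  ultimately show "limitin (discrete_topology (coeff_set \<Psi> i))
      (\<lambda>n. P_hat \<Psi> (nth_convergent \<Psi> y n) i) (P_hat \<Psi> y i) sequentially"
    by (auto simp: limitin_def elim: eventually_mono)
qed simp

theorem theorem3p16:
  fixes \<Psi> :: "('s, 'c) expansion_data" and T :: "'s topology" and y :: 's
  assumes "expansion_system \<Psi>"
    and "proper \<Psi>"
    and "topspace T = state_set \<Psi> 0"
    and "coarser_or_equal T
           (pullback_topology (state_set \<Psi> 0) (P_hat \<Psi>) (discrete_topology (C_hat \<Psi>)))"
    and "y \<in> state_set \<Psi> 0"
    and "closed_map_at T (discrete_product \<Psi>) (P_hat \<Psi>) (P_hat \<Psi> y)"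
  shows "accurate \<Psi> T y"
proof -
  note sys = assms(1) and coarser = assms(4) and y = assms(5) and closed = assms(6)
  have conv: "proper_at \<Psi> n y" for n
    using assms(2) y by (simp add: proper_def)
  have "\<forall>\<^sub>F n in sequentially. nth_convergent \<Psi> y n \<in> U" if U: "openin T U" "y \<in> U" for U
  proof -
    \<comment> \<open>Coarseness enters here: U is open in the pullback topology. Since y lies in U,
      \<open>P_hat \<Psi> y\<close> lies in A, and so U contains every state with the same
      coefficients as y.\<close>
    obtain A where A: "U = P_hat \<Psi> -` A \<inter> state_set \<Psi> 0"
      using coarser U(1) by (auto simp: coarser_or_equal_def openin_pullback_topology)
    then have "{x \<in> topspace T. P_hat \<Psi> x = P_hat \<Psi> y} \<subseteq> U"
      using U(2) assms(3) by auto
    then obtain V where V: "openin (discrete_product \<Psi>) V" "P_hat \<Psi> y \<in> V"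
        "{x \<in> topspace T. P_hat \<Psi> x \<in> V} \<subseteq> U"
      using closed U(1) unfolding closed_map_at_def by blast
    have "\<forall>\<^sub>F n in sequentially. P_hat \<Psi> (nth_convergent \<Psi> y n) \<in> V"
      using limitin_P_hat_nth_convergent[OF sys conv y] V(1,2) by (simp add: limitin_def)
    then show ?thesis
      \<comment> \<open>The inclusion for V concerns points of \<open>topspace T\<close> only, hence
        the appeal to membership of the convergents in \<open>state_set \<Psi> 0\<close>.\<close>
      by eventually_elim (use V(3) assms(3) nth_convergent_in_state_set[OF sys conv] in auto)
  qed
  then show ?thesis
    using conv y assms(3) by (simp add: accurate_def limitin_def)
qed

end
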